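(* Let $(P,\leq)$ be a down-directed poset, ${}^*$ a unary operation on $P$, $0\in P$, and $(P,\sqcap)$ a commutative meet-directoid assigned to $(P,\leq)$. Then $(P,\leq,{}^*,0)$ is a pseudocomplemented poset if and only if $(P,\sqcap,{}^*,0)$ satisfies the following conditions: (i) for all $x\in P$: $0\sqcap x=0$; (ii) for all $x,y\in P$: $(x\sqcap y)\sqcap(x^*\sqcap y)=0$; (iii) for all $x,y\in P$: if $(x\sqcap z)\sqcap(y\sqcap z)=0$ for all $z\in P$, then $y\sqcap x^*=y$.
   Context: For a poset $(P,\leq)$ and $x,y\in P$ let $L(x,y)=\{z\in P\mid z\leq x\text{ and }z\leq y\}$. The poset is down-directed if $L(x,y)\neq\emptyset$ for all $x,y\in P$. A commutative meet-directoid assigned to a down-directed poset $(P,\leq)$ is a groupoid $(P,\sqcap)$ such that for all $x,y\in P$: $x\sqcap y=y\sqcap x\in L(x,y)$, and $x\sqcap y=\min(x,y)$ whenever $x$ and $y$ are comparable (for incomparable $x,y$ the element $x\sqcap y=y\sqcap x$ is an arbitrarily chosen element of $L(x,y)$). A pseudocomplemented poset is a quadruple $(P,\leq,{}^*,0)$ such that $(P,\leq)$ is a poset with bottom element $0$ and ${}^*$ is a unary operation on $P$ such that for every $x\in P$, $x^*$ is the greatest element $y$ of $P$ satisfying $L(x,y)=\{0\}$. *)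

theory Defs
  imports "HOL-Library.FuncSet"
begin

text \<open>
  All structures live on an explicit carrier set \<open>P\<close>; relations and operations are only
  constrained on \<open>P\<close>.
\<close>

definition poset_on :: "'a set \<Rightarrow> ('a \<Rightarrow> 'a \<Rightarrow> bool) \<Rightarrow> bool" where
  "poset_on P le \<longleftrightarrow> reflp_on P le \<and> antisymp_on P le \<and> transp_on P le"

definition lower_cone :: "'a set \<Rightarrow> ('a \<Rightarrow> 'a \<Rightarrow> bool) \<Rightarrow> 'a \<Rightarrow> 'a \<Rightarrow> 'a set" where
  "lower_cone P le x y = {z \<in> P. le z x \<and> le z y}"

definition down_directed_poset :: "'a set \<Rightarrow> ('a \<Rightarrow> 'a \<Rightarrow> bool) \<Rightarrow> bool" where
  "down_directed_poset P le \<longleftrightarrow>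
     poset_on P le \<and> (\<forall>x\<in>P. \<forall>y\<in>P. lower_cone P le x y \<noteq> {})"

text \<open>
  The last conjunct says that \<open>meet x y\<close> is the minimum of \<open>x\<close> and \<open>y\<close> whenever they are
  comparable; the case \<open>le y x\<close> is covered by commutativity. Closure of \<open>P\<close> under \<open>meet\<close>
  is part of membership in the lower cone.
\<close>

definition assigned_meet_directoid ::
  "'a set \<Rightarrow> ('a \<Rightarrow> 'a \<Rightarrow> bool) \<Rightarrow> ('a \<Rightarrow> 'a \<Rightarrow> 'a) \<Rightarrow> bool" where
  "assigned_meet_directoid P le meet \<longleftrightarrow>
     (\<forall>x\<in>P. \<forall>y\<in>P. meet x y = meet y x \<and> meet x y \<in> lower_cone P le x y \<and>
        (le x y \<longrightarrow> meet x y = x))"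

definition is_bottom :: "'a set \<Rightarrow> ('a \<Rightarrow> 'a \<Rightarrow> bool) \<Rightarrow> 'a \<Rightarrow> bool" where
  "is_bottom P le b \<longleftrightarrow> b \<in> P \<and> (\<forall>x\<in>P. le b x)"

definition is_greatest :: "('a \<Rightarrow> 'a \<Rightarrow> bool) \<Rightarrow> 'a set \<Rightarrow> 'a \<Rightarrow> bool" where
  "is_greatest le A g \<longleftrightarrow> g \<in> A \<and> (\<forall>y\<in>A. le y g)"

definition pseudocomplemented_poset ::
  "'a set \<Rightarrow> ('a \<Rightarrow> 'a \<Rightarrow> bool) \<Rightarrow> ('a \<Rightarrow> 'a) \<Rightarrow> 'a \<Rightarrow> bool" where
  "pseudocomplemented_poset P le star zero \<longleftrightarrow>
     poset_on P le \<and> is_bottom P le zero \<and> star \<in> P \<rightarrow> P \<and>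
     (\<forall>x\<in>P. is_greatest le {y \<in> P. lower_cone P le x y = {zero}} (star x))"

end

theory Submission
  imports Defs
begin

text \<open>
  In a commutative meet-directoid assigned to a poset, the order is recovered from the
  operation: \<open>x \<le> y\<close> holds exactly when \<open>x \<sqinter> y = x\<close>. Hence (i) says that \<open>0\<close> is the bottom
  element. What remains is to express \<open>L(x,y) = {0}\<close> by identities, although \<open>x \<sqinter> y = 0\<close> does
  not suffice for it, because \<open>x \<sqinter> y\<close> is an arbitrary common lower bound of incomparable
  elements. The remedy is to test with every \<open>z\<close>: the element \<open>(x \<sqinter> z) \<sqinter> (y \<sqinter> z)\<close> always lies
  in \<open>L(x,y)\<close>, and it equals \<open>z\<close> if \<open>z\<close> itself lies in \<open>L(x,y)\<close>. So these elements exhaust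
  \<open>L(x,y)\<close> as \<open>z\<close> varies (lemma \<open>lower_cone_eq_image\<close>), and \<open>L(x,y) = {0}\<close> means that all of
  them are \<open>0\<close>. Under this translation (ii) reads \<open>L(x,x\<^sup>*) = {0}\<close>, and (iii) reads that
  \<open>L(x,y) = {0}\<close> implies \<open>y \<le> x\<^sup>*\<close>; together they define the pseudocomplement.
\<close>

lemma meet_directoid_closed:
  assumes "assigned_meet_directoid P le meet" "x \<in> P" "y \<in> P"
  shows "meet x y \<in> P"
  using assms unfolding assigned_meet_directoid_def lower_cone_def by blast

lemma meet_directoid_lower:
  assumes "assigned_meet_directoid P le meet" "x \<in> P" "y \<in> P"
  shows "le (meet x y) x" "le (meet x y) y"
  using assms unfolding assigned_meet_directoid_def lower_cone_def by blast+

lemma meet_directoid_commute: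
  assumes "assigned_meet_directoid P le meet" "x \<in> P" "y \<in> P"
  shows "meet x y = meet y x"
  using assms unfolding assigned_meet_directoid_def by blast

lemma meet_directoid_le_iff:
  assumes "assigned_meet_directoid P le meet" "x \<in> P" "y \<in> P"
  shows "le x y \<longleftrightarrow> meet x y = x"
  using assms meet_directoid_lower(2)[OF assms]
  unfolding assigned_meet_directoid_def by metis

text \<open>
  Membership of \<open>(x \<sqinter> z) \<sqinter> (y \<sqinter> z)\<close> in the cone is transitivity alone; conversely, each member
  \<open>z\<close> of the cone is its own witness, since \<open>x \<sqinter> z = z = y \<sqinter> z\<close>. This replaces a quantifier
  over common lower bounds by an unrestricted one, which an equational condition can express.
\<close>

lemma lower_cone_eq_image:
  assumes pos: "poset_on P le" and dir: "assigned_meet_directoid P le meet"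
    and x: "x \<in> P" and y: "y \<in> P"
  shows "lower_cone P le x y = (\<lambda>z. meet (meet x z) (meet y z)) ` P"
proof (intro equalityI subsetI)
  fix z assume "z \<in> lower_cone P le x y"
  then have z: "z \<in> P" "le z x" "le z y"
    by (auto simp: lower_cone_def)
  have "meet x z = z" "meet y z = z"
    using z x y meet_directoid_le_iff[OF dir] meet_directoid_commute[OF dir] by metis+
  moreover have "meet z z = z"
    using pos z(1) meet_directoid_le_iff[OF dir] by (auto simp: poset_on_def reflp_on_def)
  ultimately have "z = meet (meet x z) (meet y z)"
    by simp
  then show "z \<in> (\<lambda>z. meet (meet x z) (meet y z)) ` P"
    using z(1) by (rule image_eqI)
next
  fix w assume "w \<in> (\<lambda>z. meet (meet x z) (meet y z)) ` P"
  then obtain z where z: "z \<in> P" and w: "w = meet (meet x z) (meet y z)"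
    by blast
  have P: "meet x z \<in> P" "meet y z \<in> P" "w \<in> P"
    using x y z w meet_directoid_closed[OF dir] by simp_all
  have "transp_on P le"
    using pos by (simp add: poset_on_def)
  moreover have "le w (meet x z)" "le w (meet y z)"
    using P meet_directoid_lower[OF dir] w by simp_all
  moreover have "le (meet x z) x" "le (meet y z) y"
    using x y z meet_directoid_lower(1)[OF dir] by simp_all
  ultimately have "le w x" "le w y"
    using P x y by (blast dest: transp_onD)+
  then show "w \<in> lower_cone P le x y"
    using P(3) by (simp add: lower_cone_def)
qed

lemma lower_cone_eq_singleton_iff:
  assumes "poset_on P le" and "assigned_meet_directoid P le meet"
    and "x \<in> P" and "y \<in> P"
  shows "lower_cone P le x y = {b} \<longleftrightarrow> (\<forall>z\<in>P. meet (meet x z) (meet y z) = b)"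
  unfolding lower_cone_eq_image[OF assms] using \<open>x \<in> P\<close> by auto

theorem theorem3p4:
  fixes P :: "'a set" and le :: "'a \<Rightarrow> 'a \<Rightarrow> bool"
    and star :: "'a \<Rightarrow> 'a" and zero :: 'a and meet :: "'a \<Rightarrow> 'a \<Rightarrow> 'a"
  assumes "down_directed_poset P le"
    and "star \<in> P \<rightarrow> P"
    and "zero \<in> P"
    and "assigned_meet_directoid P le meet"
  shows "pseudocomplemented_poset P le star zero \<longleftrightarrow>
     (\<forall>x\<in>P. meet zero x = zero) \<and>
     (\<forall>x\<in>P. \<forall>y\<in>P. meet (meet x y) (meet (star x) y) = zero) \<and>
     (\<forall>x\<in>P. \<forall>y\<in>P. (\<forall>z\<in>P. meet (meet x z) (meet y z) = zero) \<longrightarrow> meet y (star x) = y)"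
proof -
  have pos: "poset_on P le"
    using assms(1) by (simp add: down_directed_poset_def)
  have star: "star x \<in> P" if "x \<in> P" for x
    using assms(2) that by blast
  note le_iff = meet_directoid_le_iff[OF assms(4)]
  note cone_iff = lower_cone_eq_singleton_iff[OF pos assms(4)]
  have bottom: "is_bottom P le zero \<longleftrightarrow> (\<forall>x\<in>P. meet zero x = zero)"
    using assms(3) le_iff by (simp add: is_bottom_def)
  have greatest: "is_greatest le {y \<in> P. lower_cone P le x y = {zero}} (star x) \<longleftrightarrow>
      (\<forall>y\<in>P. meet (meet x y) (meet (star x) y) = zero) \<and>
      (\<forall>y\<in>P. (\<forall>z\<in>P. meet (meet x z) (meet y z) = zero) \<longrightarrow> meet y (star x) = y)"
    if "x \<in> P" for x
    using that star[OF that] by (auto simp: is_greatest_def cone_iff le_iff)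
  show ?thesis
    unfolding pseudocomplemented_poset_def bottom
    using pos assms(2) greatest by auto
qed

end
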